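(* Let $(\phi_t)$ be a non-elliptic semigroup in $\mathbb D$ with Denjoy-Wolff point $1$ and orthogonal speed $v^o(t)$. For $t\ge1$, let $a_t\in\partial\mathbb D\cap\{\mathrm{Im}\,z>0\}$ be the intersection of $\partial\mathbb D$ with the circle containing $\phi_t(0)$, orthogonal to $(-1,1)$ and orthogonal to $\partial\mathbb D$ at $a_t$. Let $A_t\subset\partial\mathbb D$ be the closed arc containing $1$ and with end points $a_t$ and $\overline{a_t}$. Then there exists a constant $K>0$ such that $$\left|v^o(t)+\frac12\log\omega(0,A_t,\mathbb D)\right|\le K\quad\text{for all }t\ge1.$$
   Context: Let $\mathbb D=\{z\in\mathbb C:|z|<1\}$. A (continuous) semigroup in $\mathbb D$ is a family $(\phi_t)_{t\ge0}$ of holomorphic self-maps of $\mathbb D$ with $\phi_0=\mathrm{id}$, $\phi_{s+t}=\phi_s\circ\phi_t$, and $t\mapsto\phi_t$ continuous for uniform convergence on compacta. It is non-elliptic if it has no fixed points in $\mathbb D$ (no $z\in\mathbb D$ with $\phi_t(z)=z$ for all $t\geq 0$). In that case there is a unique $\tau\in\partial\mathbb D$, the Denjoy-Wolff point, with $\lim_{t\to+\infty}\phi_t(z)=\tau$ for all $z\in\mathbb D$. When $\tau=1$, one has $\mathrm{Re}\,\phi_t(0)>0$ for every $t>0$. Let $k_{\mathbb D}$ be the hyperbolic distance of $\mathbb D$, normalized by $k_{\mathbb D}(0,z)=\frac12\log\frac{1+|z|}{1-|z|}$. For $z\in\mathbb D$ let $\pi(z)$ be the unique point of the geodesic $(-1,1)\tau$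 that is closest to $z$ with respect to $k_{\mathbb D}$. The orthogonal speed of $(\phi_t)$ is $v^o(t):=k_{\mathbb D}(0,\pi(\phi_t(0)))$, $t\ge0$. $\omega(w,D,\Omega)$ denotes the harmonic measure at $w\in\Omega$ of the set $D\subset\partial\Omega$ with respect to the simply connected domain $\Omega\subsetneq\mathbb C$. *)

theory Defs
  imports "HOL-Complex_Analysis.Complex_Analysis"
begin

section \<open>Semigroups of holomorphic self-maps of the unit disc\<close>

abbreviation unit_disc :: "complex set"
  where "unit_disc \<equiv> ball 0 1"

definition hol_semigroup :: "(real \<Rightarrow> complex \<Rightarrow> complex) \<Rightarrow> bool" where
  "hol_semigroup \<phi> \<longleftrightarrow>
     (\<forall>t\<ge>0. \<phi> t holomorphic_on unit_disc \<and> \<phi> t ` unit_disc \<subseteq> unit_disc) \<and>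
     (\<forall>z\<in>unit_disc. \<phi> 0 z = z) \<and>
     (\<forall>s\<ge>0. \<forall>t\<ge>0. \<forall>z\<in>unit_disc. \<phi> (s + t) z = \<phi> s (\<phi> t z)) \<and>
     (\<forall>C. compact C \<and> C \<subseteq> unit_disc \<longrightarrow>
        (\<forall>s\<ge>0. uniform_limit C \<phi> (\<phi> s) (at s within {0..})))"

definition non_elliptic :: "(real \<Rightarrow> complex \<Rightarrow> complex) \<Rightarrow> bool" where
  "non_elliptic \<phi> \<longleftrightarrow> \<not> (\<exists>z\<in>unit_disc. \<forall>t\<ge>0. \<phi> t z = z)"

definition is_Denjoy_Wolff_point :: "(real \<Rightarrow> complex \<Rightarrow> complex) \<Rightarrow> complex \<Rightarrow> bool" where
  "is_Denjoy_Wolff_point \<phi> \<tau> \<longleftrightarrow>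
     \<tau> \<in> sphere 0 1 \<and> (\<forall>z\<in>unit_disc. ((\<lambda>t. \<phi> t z) \<longlongrightarrow> \<tau>) at_top)"

definition Denjoy_Wolff_point :: "(real \<Rightarrow> complex \<Rightarrow> complex) \<Rightarrow> complex" where
  "Denjoy_Wolff_point \<phi> = (THE \<tau>. is_Denjoy_Wolff_point \<phi> \<tau>)"


section \<open>Hyperbolic distance and orthogonal speed\<close>

definition hyp_dist :: "complex \<Rightarrow> complex \<Rightarrow> real" where
  "hyp_dist z w =
     (let \<rho> = cmod ((z - w) / (1 - cnj z * w)) in 1/2 * ln ((1 + \<rho>) / (1 - \<rho>)))"

definition diameter_geodesic :: "complex \<Rightarrow> complex set" where
  "diameter_geodesic \<tau> = (\<lambda>r. of_real r * \<tau>) ` {-1<..<1}"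

definition geodesic_proj :: "complex \<Rightarrow> complex \<Rightarrow> complex" where
  "geodesic_proj \<tau> z =
     (THE p. p \<in> diameter_geodesic \<tau> \<and>
             (\<forall>q\<in>diameter_geodesic \<tau>. hyp_dist z p \<le> hyp_dist z q))"

definition orthogonal_speed :: "(real \<Rightarrow> complex \<Rightarrow> complex) \<Rightarrow> real \<Rightarrow> real" where
  "orthogonal_speed \<phi> t = hyp_dist 0 (geodesic_proj (Denjoy_Wolff_point \<phi>) (\<phi> t 0))"


section \<open>Harmonic measure\<close>

definition subharmonic_on :: "(complex \<Rightarrow> real) \<Rightarrow> complex set \<Rightarrow> bool" where
  "subharmonic_on u \<Omega> \<longleftrightarrow> continuous_on \<Omega> u \<and>
     (\<forall>z r. 0 < r \<and> cball z r \<subseteq> \<Omega> \<longrightarrow>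
        u z \<le> 1 / (2 * pi) * integral {0..2 * pi} (\<lambda>\<theta>. u (z + of_real r * cis \<theta>)))"

text \<open>
  Harmonic measure is the Perron solution of the Dirichlet problem whose boundary data is the
  indicator function of \<open>E\<close>. On a simply connected proper subdomain of the plane it makes no
  difference whether the competitors are continuous or only upper semicontinuous: every boundary
  point is regular, so for compact \<open>C \<subseteq> E\<close> the harmonic measure of \<open>C\<close> is itself a competitor,
  and Borel \<open>E\<close> are approximated by such \<open>C\<close>. The competitors are bounded above so that the
  point at infinity carries no mass when \<open>\<Omega>\<close> is unbounded.
\<close>

definition harmonic_measure :: "complex \<Rightarrow> complex set \<Rightarrow> complex set \<Rightarrow> real" where
  "harmonic_measure w E \<Omega> =
     Sup {u w | u. subharmonic_on u \<Omega> \<and> bdd_above (u ` \<Omega>) \<and>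
                   (\<forall>\<zeta>\<in>frontier \<Omega>.
                      Limsup (at \<zeta> within \<Omega>) (\<lambda>z. ereal (u z)) \<le> indicator E \<zeta>)}"


section \<open>The arcs cut out by circles orthogonal to the real diameter\<close>

text \<open>
  The tangent to \<open>sphere c r\<close> at one of its points \<open>p\<close> has direction \<open>\<i> * (p - c)\<close>; the real
  diameter has direction \<open>1\<close> and the unit circle has tangent \<open>\<i> * a\<close> at \<open>a\<close>.
\<close>

definition orthogonal_to_diameter :: "complex \<Rightarrow> real \<Rightarrow> bool" where
  "orthogonal_to_diameter c r \<longleftrightarrow>
     (\<exists>p \<in> sphere c r \<inter> diameter_geodesic 1. orthogonal (\<i> * (p - c)) 1)"

definition orthogonal_to_unit_circle_at :: "complex \<Rightarrow> real \<Rightarrow> complex \<Rightarrow> bool" where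
  "orthogonal_to_unit_circle_at c r a \<longleftrightarrow>
     a \<in> sphere c r \<inter> sphere 0 1 \<and> orthogonal (\<i> * (a - c)) (\<i> * a)"

definition upper_endpoint :: "complex \<Rightarrow> complex" where
  "upper_endpoint z =
     (THE a. a \<in> sphere 0 1 \<and> Im a > 0 \<and>
        (\<exists>c r. r > 0 \<and> z \<in> sphere c r \<and> orthogonal_to_diameter c r \<and>
               orthogonal_to_unit_circle_at c r a))"

text \<open>
  For \<open>a\<close> on the unit circle with \<open>Im a > 0\<close> we have \<open>Arg a \<in> {0<..<pi}\<close>, so this is the closed
  arc with end points \<open>a\<close> and \<open>cnj a\<close> that contains \<open>1\<close>.
\<close>

definition arc_through_1 :: "complex \<Rightarrow> complex set" where
  "arc_through_1 a = cis ` {- Arg a..Arg a}"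

end

theory Submission
  imports Defs
begin

text \<open>
  Both quantities are explicit functions of one angle. Let \<open>z = \<phi> t 0\<close> and let \<open>a = cis \<theta>\<close> be the
  upper end point of the circle through \<open>z\<close> that is orthogonal to the real diameter and to the
  unit circle. Such a circle has the real centre \<open>1 / cos \<theta>\<close>, so passing through \<open>z\<close> means
  \<open>cos \<theta> = 2 * Re z / (1 + \<bar>z\<bar>\<^sup>2)\<close>. The circle is a hyperbolic geodesic perpendicular to the diameter,
  hence it meets the diameter in the projection \<open>p\<close> of \<open>z\<close>; with \<open>T = tan (\<theta> / 2)\<close> this is
  \<open>p = (1 - T) / (1 + T)\<close>, and the orthogonal speed is \<open>- 1/2 * ln T\<close>. The harmonic measure of the
  arc of half-angle \<open>\<theta>\<close>, seen from the centre, is its normalised length \<open>\<theta> / pi\<close>. The quantity to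
  be bounded is therefore \<open>1/2 * ln (\<theta> / (pi * tan (\<theta> / 2)))\<close>.

  For \<open>0 < \<theta> < pi / 2\<close> the quotient lies between \<open>1 / pi\<close> and \<open>1\<close>, so \<open>K = 1/2 * ln pi\<close> works. As
  \<open>\<theta>\<close> tends to \<open>pi\<close> the speed blows up while the harmonic measure tends to \<open>1\<close>; so
  \<open>\<theta>\<close> has to stay away from \<open>pi\<close>. It does, since \<open>\<theta> < pi / 2\<close> means \<open>Re (\<phi> t 0) > 0\<close>, and this
  is the inequality that Wolff's lemma gives at the origin (\<open>Re_orbit_pos\<close>), obtained here from the Schwarz lemma along the orbit.

  The value of the harmonic measure (\<open>harmonic_measure_arc\<close>) is found by squeezing. Every Perron
  competitor is bounded at \<open>0\<close> by its means over circles of radius tending to \<open>1\<close>, and these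
  are controlled by the boundary condition and dominated convergence. Conversely the imaginary part
  of a difference of two logarithms is harmonic with exactly the right boundary values.
\<close>

section \<open>Positivity of the real part along the orbit of the origin\<close>

lemma pseudo_hyperbolic_identity:
  assumes "1 - cnj z * w \<noteq> 0"
  shows "1 - (cmod ((z - w) / (1 - cnj z * w)))\<^sup>2
       = (1 - (cmod z)\<^sup>2) * (1 - (cmod w)\<^sup>2) / (cmod (1 - cnj z * w))\<^sup>2"
proof -
  have "(cmod (1 - cnj z * w))\<^sup>2 - (cmod (z - w))\<^sup>2 = (1 - (cmod z)\<^sup>2) * (1 - (cmod w)\<^sup>2)"
    by (simp add: cmod_power2) (simp add: power2_eq_square algebra_simps)
  then show ?thesis
    using assms by (simp add: norm_divide power_divide field_simps)
qed

lemma one_minus_cnj_mult_nonzero: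
  assumes "z \<in> unit_disc" "w \<in> unit_disc"
  shows "1 - cnj z * w \<noteq> 0"
proof
  assume "1 - cnj z * w = 0"
  then have "cmod z * cmod w = 1"
    by (metis complex_mod_cnj norm_mult norm_one eq_iff_diff_eq_0)
  moreover have "cmod z * cmod w < 1"
    using assms mult_strict_mono'[of "cmod z" 1 "cmod w" 1] by simp
  ultimately show False by simp
qed

text \<open>
  The Schwarz lemma applied to \<open>f\<close> followed by the disc automorphism that sends \<open>f 0\<close> to \<open>0\<close>. In
  this form without quotients both sides can be compared as \<open>w\<close> approaches the unit circle.
\<close>

lemma Schwarz_Pick_at_0:
  assumes "f holomorphic_on unit_disc" "f ` unit_disc \<subseteq> unit_disc" "w \<in> unit_disc"
  shows "(cmod (1 - cnj (f 0) * f w))\<^sup>2 * (1 - (cmod w)\<^sup>2)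
       \<le> (1 - (cmod (f 0))\<^sup>2) * (1 - (cmod (f w))\<^sup>2)"
proof -
  have disc: "f z \<in> unit_disc" if "z \<in> unit_disc" for z
    using assms(2) that by blast
  define g where "g = (\<lambda>z. Moebius_function 0 (f 0) (f z))"
  have f0: "cmod (f 0) < 1"
    using disc[of 0] by simp
  have "g holomorphic_on unit_disc"
    using holomorphic_on_compose_gen[OF assms(1) Moebius_function_holomorphic[OF f0] assms(2)]
    by (simp add: g_def comp_def)
  moreover have "g 0 = 0"
    by (simp add: g_def Moebius_function_eq_zero)
  moreover have "cmod (g z) < 1" if "cmod z < 1" for z
    unfolding g_def using disc[of z] that f0 by (intro Moebius_function_norm_lt_1) auto
  ultimately have "cmod (g w) \<le> cmod w"
    using assms(3) by (intro Schwarz_Lemma) auto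
  then have le: "(cmod (g w))\<^sup>2 \<le> (cmod w)\<^sup>2"
    by (intro power_mono) auto
  have nz: "1 - cnj (f 0) * f w \<noteq> 0"
    using disc[of 0] disc[OF assms(3)] by (intro one_minus_cnj_mult_nonzero) auto
  have "cmod (g w) = cmod ((f 0 - f w) / (1 - cnj (f 0) * f w))"
    by (simp add: g_def Moebius_function_simple norm_divide norm_minus_commute)
  then have "1 - (cmod (g w))\<^sup>2
      = (1 - (cmod (f 0))\<^sup>2) * (1 - (cmod (f w))\<^sup>2) / (cmod (1 - cnj (f 0) * f w))\<^sup>2"
    using pseudo_hyperbolic_identity[OF nz] by simp
  with le have "1 - (cmod w)\<^sup>2
      \<le> (1 - (cmod (f 0))\<^sup>2) * (1 - (cmod (f w))\<^sup>2) / (cmod (1 - cnj (f 0) * f w))\<^sup>2"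
    by linarith
  then show ?thesis
    using nz by (simp add: pos_le_divide_eq mult.commute)
qed

text \<open>
  With \<open>b = \<phi> t 0\<close>, apply the previous inequality to \<open>\<phi> t\<close> at the iterates \<open>w n = \<phi> (n * t) 0\<close>. Their
  moduli tend to \<open>1\<close> from below, so for infinitely many \<open>n\<close> the step from \<open>w n\<close> to \<open>w (n + 1)\<close> does not
  decrease the modulus. For these \<open>n\<close> the factor \<open>1 - \<bar>w n\<bar>\<^sup>2\<close> can be cancelled, and the limit gives \<open>\<bar>1 - b\<bar>\<^sup>2 \<le> 1 - \<bar>b\<bar>\<^sup>2\<close>: the point \<open>b\<close> lies in
  the horodisc at \<open>1\<close> whose boundary passes through \<open>0\<close>.
\<close>

lemma Re_orbit_pos:
  assumes "hol_semigroup \<phi>" "is_Denjoy_Wolff_point \<phi> 1" "t > 0"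
  shows "Re (\<phi> t 0) > 0"
proof -
  have hol: "\<phi> s holomorphic_on unit_disc" and self: "\<phi> s ` unit_disc \<subseteq> unit_disc" if "s \<ge> 0" for s
    using assms(1) that by (simp_all add: hol_semigroup_def)
  define w where "w = (\<lambda>n. \<phi> (real n * t) 0)"
  have w0: "w 0 = 0" and step: "w (Suc n) = \<phi> t (w n)" for n
  proof -
    show "w 0 = 0"
      using assms(1) by (simp add: w_def hol_semigroup_def)
    have "\<phi> (t + real n * t) 0 = \<phi> t (\<phi> (real n * t) 0)"
      using assms(1,3) by (simp add: hol_semigroup_def)
    then show "w (Suc n) = \<phi> t (w n)"
      by (simp add: w_def algebra_simps)
  qed
  have wdisc: "w n \<in> unit_disc" for n
    unfolding w_def using self[of "real n * t"] assms(3) by (auto simp: image_subset_iff)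
  have "filterlim (\<lambda>n. real n * t) at_top sequentially"
    by (rule filterlim_at_top_mult_tendsto_pos[OF tendsto_const assms(3) filterlim_real_sequentially])
  moreover have "((\<lambda>t. \<phi> t 0) \<longlongrightarrow> 1) at_top"
    using assms(2) by (simp add: is_Denjoy_Wolff_point_def)
  ultimately have lim: "w \<longlonglongrightarrow> 1"
    unfolding w_def by (rule filterlim_compose[rotated])
  have frequent: "\<exists>n\<ge>N. cmod (w n) \<le> cmod (w (Suc n))" for N
  proof (rule ccontr)
    assume "\<not> ?thesis"
    then have dec: "cmod (w (Suc n)) \<le> cmod (w n)" if "n \<ge> N" for n
      using that by force
    have "cmod (w n) \<le> cmod (w N)" if "n \<ge> N" for n
      using that by (induction rule: dec_induct) (auto intro: order_trans dec)
    moreover have "(\<lambda>n. cmod (w n)) \<longlonglongrightarrow> cmod 1"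
      by (intro tendsto_norm lim)
    ultimately have "cmod 1 \<le> cmod (w N)"
      by (intro LIMSEQ_le_const2) auto
    then show False
      using wdisc[of N] by simp
  qed
  define b where "b = \<phi> t 0"
  have le: "(cmod (1 - cnj b * w (Suc n)))\<^sup>2 \<le> 1 - (cmod b)\<^sup>2"
    if "cmod (w n) \<le> cmod (w (Suc n))" for n
  proof -
    have "(cmod (w n))\<^sup>2 \<le> (cmod (w (Suc n)))\<^sup>2"
      using that by (intro power_mono) auto
    moreover have "0 < 1 - (cmod (w n))\<^sup>2"
      using wdisc[of n] by (simp add: power_less_one_iff)
    moreover have "0 \<le> 1 - (cmod b)\<^sup>2"
      using wdisc[of 1] step[of 0] w0 by (simp add: b_def power_le_one)
    moreover have "(cmod (1 - cnj b * w (Suc n)))\<^sup>2 * (1 - (cmod (w n))\<^sup>2)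
        \<le> (1 - (cmod b)\<^sup>2) * (1 - (cmod (w (Suc n)))\<^sup>2)"
      using Schwarz_Pick_at_0[OF hol self wdisc, of t n] assms(3) by (simp add: b_def step)
    ultimately have "(cmod (1 - cnj b * w (Suc n)))\<^sup>2 * (1 - (cmod (w n))\<^sup>2)
        \<le> (1 - (cmod b)\<^sup>2) * (1 - (cmod (w n))\<^sup>2)"
      by (smt (verit, best) mult_left_mono)
    then show ?thesis
      using \<open>0 < 1 - (cmod (w n))\<^sup>2\<close> by simp
  qed
  have lim2: "(\<lambda>n. (cmod (1 - cnj b * w (Suc n)))\<^sup>2) \<longlonglongrightarrow> (cmod (1 - cnj b * 1))\<^sup>2"
    by (intro tendsto_intros LIMSEQ_Suc lim)
  have "(cmod (1 - cnj b))\<^sup>2 \<le> 1 - (cmod b)\<^sup>2"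
  proof (rule ccontr)
    assume "\<not> ?thesis"
    then have "\<forall>\<^sub>F n in sequentially. 1 - (cmod b)\<^sup>2 < (cmod (1 - cnj b * w (Suc n)))\<^sup>2"
      using order_tendstoD(1)[OF lim2] by simp
    then obtain N where "\<And>n. n \<ge> N \<Longrightarrow> 1 - (cmod b)\<^sup>2 < (cmod (1 - cnj b * w (Suc n)))\<^sup>2"
      by (auto simp: eventually_sequentially)
    moreover obtain n where "n \<ge> N" "cmod (w n) \<le> cmod (w (Suc n))"
      using frequent by blast
    ultimately show False
      using le[of n] by force
  qed
  then have "(cmod b)\<^sup>2 \<le> Re b"
    by (simp add: cmod_power2) (simp add: power2_eq_square algebra_simps)
  moreover have "b \<noteq> 0"
  proof
    assume "b = 0"
    then have "w n = 0" for n
      by (induction n) (simp_all add: w0 step b_def)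
    then have "w = (\<lambda>n. 0)" by auto
    with lim show False
      using LIMSEQ_unique[OF _ tendsto_const] by force
  qed
  ultimately show ?thesis
    by (smt (verit) b_def zero_less_norm_iff zero_less_power)
qed

section \<open>The orthogonal circle and the hyperbolic projection\<close>

text \<open>
  Orthogonality to the diameter makes the centre \<open>c\<close> real, and orthogonality to the unit circle at \<open>a\<close>
  makes \<open>c * Re a = 1\<close>. The circle has centre \<open>1 / cos \<theta>\<close> and radius \<open>\<bar>tan \<theta>\<bar>\<close>, and the second
  condition on \<open>\<theta>\<close> says that it passes through \<open>z\<close>.
\<close>

lemma upper_endpoint_eq_cis:
  assumes z: "z \<in> unit_disc" and \<theta>: "0 < \<theta>" "\<theta> < pi"
    and cos: "cos \<theta> \<noteq> 0" "cos \<theta> * (1 + (cmod z)\<^sup>2) = 2 * Re z"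
  shows "upper_endpoint z = cis \<theta>"
  unfolding upper_endpoint_def
proof (rule the_equality)
  have sin: "sin \<theta> > 0"
    using \<theta> by (simp add: sin_gt_zero)
  \<comment> \<open>The point of the diameter on the circle: it equals \<open>(1 - sin \<theta>) / cos \<theta>\<close>, at distance
    \<open>\<bar>tan \<theta>\<bar>\<close> from the centre, and in the present form it is visibly of modulus less than \<open>1\<close>.\<close>
  define p where "p = cos \<theta> / (1 + sin \<theta>)"
  have p: "\<bar>p\<bar> < 1"
  proof -
    have "\<bar>cos \<theta>\<bar> \<le> 1" by simp
    then have "\<bar>cos \<theta>\<bar> < 1 + sin \<theta>" using sin by linarith
    then show ?thesis using sin by (simp add: p_def abs_divide)
  qed
  have one: "(cos \<theta>)\<^sup>2 + (sin \<theta>)\<^sup>2 = 1" by simp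
  have "dist (complex_of_real (1 / cos \<theta>)) z = \<bar>tan \<theta>\<bar>"
  proof -
    have "(dist (complex_of_real (1 / cos \<theta>)) z)\<^sup>2 = 1 / (cos \<theta>)\<^sup>2 - 2 * Re z / cos \<theta> + (cmod z)\<^sup>2"
      using cos(1) by (simp add: dist_norm cmod_power2) (simp add: power2_eq_square field_simps)
    also have "\<dots> = 1 / (cos \<theta>)\<^sup>2 - 1"
      unfolding cos(2)[symmetric] using cos(1) by (simp add: field_simps)
    also have "\<dots> = (tan \<theta>)\<^sup>2"
      using cos(1) one by (simp add: tan_def field_simps power2_eq_square)
    finally show ?thesis
      by (metis abs_of_nonneg power2_abs power2_eq_iff_nonneg zero_le_dist abs_ge_zero)
  qed
  moreover have "dist (complex_of_real (1 / cos \<theta>)) (of_real p) = \<bar>tan \<theta>\<bar>"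
  proof -
    have "p = (1 - sin \<theta>) / cos \<theta>"
      unfolding p_def using cos(1) sin one by (subst frac_eq_eq) (auto simp: power2_eq_square algebra_simps)
    then have "1 / cos \<theta> - p = tan \<theta>"
      by (simp add: tan_def diff_divide_distrib)
    then show ?thesis
      by (metis dist_norm norm_of_real of_real_diff real_norm_def)
  qed
  moreover have "of_real p \<in> diameter_geodesic 1"
    using p by (auto simp: diameter_geodesic_def abs_less_iff)
  moreover have "dist (complex_of_real (1 / cos \<theta>)) (cis \<theta>) = \<bar>tan \<theta>\<bar>"
  proof -
    have "(dist (complex_of_real (1 / cos \<theta>)) (cis \<theta>))\<^sup>2 = (1 / cos \<theta> - cos \<theta>)\<^sup>2 + (sin \<theta>)\<^sup>2"
      by (simp add: dist_norm cmod_power2)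
    also have "\<dots> = 1 / (cos \<theta>)\<^sup>2 - 2 + ((cos \<theta>)\<^sup>2 + (sin \<theta>)\<^sup>2)"
      using cos(1) by (simp add: power2_diff power_divide)
    also have "\<dots> = (tan \<theta>)\<^sup>2"
      using cos(1) one by (simp add: tan_def field_simps power2_eq_square)
    finally show ?thesis
      by (metis power2_abs power2_eq_iff_nonneg zero_le_dist abs_ge_zero)
  qed
  moreover have "\<bar>tan \<theta>\<bar> > 0"
    using cos(1) sin by (simp add: tan_def)
  moreover have "orthogonal (\<i> * (cis \<theta> - of_real (1 / cos \<theta>))) (\<i> * cis \<theta>)"
    using cos(1) sin_squared_eq[of \<theta>]
    by (simp add: orthogonal_def inner_complex_def left_diff_distrib flip: power2_eq_square)
  moreover have "orthogonal (\<i> * (of_real p - of_real (1 / cos \<theta>))) 1"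
    by (simp add: orthogonal_def inner_complex_def)
  ultimately show "cis \<theta> \<in> sphere 0 1 \<and> Im (cis \<theta>) > 0 \<and>
        (\<exists>c r. r > 0 \<and> z \<in> sphere c r \<and> orthogonal_to_diameter c r \<and>
               orthogonal_to_unit_circle_at c r (cis \<theta>))"
    using sin unfolding orthogonal_to_diameter_def orthogonal_to_unit_circle_at_def
    by (intro conjI exI[of _ "complex_of_real (1 / cos \<theta>)"] exI[of _ "\<bar>tan \<theta>\<bar>"]
        bexI[of _ "of_real p"]) auto
next
  fix a
  assume a: "a \<in> sphere 0 1 \<and> Im a > 0 \<and>
        (\<exists>c r. r > 0 \<and> z \<in> sphere c r \<and> orthogonal_to_diameter c r \<and>
               orthogonal_to_unit_circle_at c r a)"
  then obtain c r where zc: "cmod (c - z) = r" and dia: "orthogonal_to_diameter c r"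
    and ac: "cmod (c - a) = r" and orth: "orthogonal (\<i> * (a - c)) (\<i> * a)"
    by (auto simp: orthogonal_to_unit_circle_at_def dist_norm)
  from dia have c: "Im c = 0"
    by (auto simp: orthogonal_to_diameter_def diameter_geodesic_def orthogonal_def inner_complex_def)
  have a1: "(Re a)\<^sup>2 + (Im a)\<^sup>2 = 1"
    using a by (auto simp flip: cmod_power2)
  have ca: "Re c * Re a = 1"
    using orth a1 c by (simp add: orthogonal_def inner_complex_def power2_eq_square algebra_simps)
  have "(cmod (c - z))\<^sup>2 = (cmod (c - a))\<^sup>2"
    using zc ac by simp
  then have "(cmod z)\<^sup>2 - 2 * Re c * Re z = 1 - 2 * (Re c * Re a)"
    using c a1 by (simp add: cmod_power2) (simp add: power2_eq_square algebra_simps)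
  then have "1 + (cmod z)\<^sup>2 = 2 * Re c * Re z"
    using ca by simp
  then have "(1 + (cmod z)\<^sup>2) * Re a = (1 + (cmod z)\<^sup>2) * cos \<theta>"
    using ca cos(2) by (metis mult.assoc mult.commute mult.left_neutral)
  then have re: "Re a = cos \<theta>"
    by (smt (verit) mult_cancel_left zero_le_power2)
  then have "(Im a)\<^sup>2 = (sin \<theta>)\<^sup>2"
    using a1 sin_squared_eq[of \<theta>] by simp
  then have "Im a = sin \<theta>"
    using a \<theta> by (simp add: power2_eq_iff_nonneg sin_ge_zero)
  with re show "a = cis \<theta>"
    by (simp add: complex_eq_iff)
qed

text \<open>
  Points are compared by the quotient that appears in the identity for the pseudo-hyperbolic
  distance; for real points it is a rational function, so minimising the hyperbolic distance over
  the diameter becomes algebra.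
\<close>

lemma hyp_dist_less_iff:
  assumes "z \<in> unit_disc" "v \<in> unit_disc" "w \<in> unit_disc"
  shows "hyp_dist z v < hyp_dist z w \<longleftrightarrow>
     (1 - (cmod w)\<^sup>2) / (cmod (1 - cnj z * w))\<^sup>2 < (1 - (cmod v)\<^sup>2) / (cmod (1 - cnj z * v))\<^sup>2"
    (is "_ \<longleftrightarrow> ?closer")
proof -
  define \<rho> where "\<rho> = (\<lambda>x. cmod ((z - x) / (1 - cnj z * x)))"
  have z: "1 - (cmod z)\<^sup>2 > 0"
    using assms(1) by (simp add: power_less_one_iff)
  have \<rho>_eq: "1 - (\<rho> x)\<^sup>2 = (1 - (cmod z)\<^sup>2) * ((1 - (cmod x)\<^sup>2) / (cmod (1 - cnj z * x))\<^sup>2)"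
    if "x \<in> unit_disc" for x
    using pseudo_hyperbolic_identity one_minus_cnj_mult_nonzero[OF assms(1) that]
    by (simp add: \<rho>_def)
  have \<rho>_less: "\<rho> x < 1" if "x \<in> unit_disc" for x
  proof -
    have "1 - (\<rho> x)\<^sup>2 > 0"
      unfolding \<rho>_eq[OF that] using z that one_minus_cnj_mult_nonzero[OF assms(1) that]
      by (intro mult_pos_pos divide_pos_pos) (auto simp: power_less_one_iff)
    then show ?thesis
      by (simp add: \<rho>_def power_less_one_iff)
  qed
  have mono: "1/2 * ln ((1 + x) / (1 - x)) < 1/2 * ln ((1 + y) / (1 - y))"
    if "0 \<le> x" "x < y" "y < 1" for x y :: real
    using that by (simp add: field_simps)
  have "hyp_dist z v < hyp_dist z w \<longleftrightarrow> \<rho> v < \<rho> w"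
    using mono[of "\<rho> v" "\<rho> w"] mono[of "\<rho> w" "\<rho> v"] \<rho>_less[OF assms(2)] \<rho>_less[OF assms(3)]
    by (auto simp: hyp_dist_def Let_def \<rho>_def) (smt (verit) norm_ge_zero)+
  also have "\<dots> \<longleftrightarrow> 1 - (\<rho> w)\<^sup>2 < 1 - (\<rho> v)\<^sup>2"
    by (auto simp: \<rho>_def intro: power2_less_imp_less power_strict_mono)
  also have "\<dots> \<longleftrightarrow> ?closer"
    unfolding \<rho>_eq[OF assms(2)] \<rho>_eq[OF assms(3)] using z by (rule mult_less_cancel_left_pos)
  finally show ?thesis .
qed

text \<open>
  The condition on \<open>p\<close> is the critical point equation of \<open>(1 - x\<^sup>2) / \<bar>1 - cnj z * x\<bar>\<^sup>2\<close>. For \<open>p \<noteq> 0\<close> it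
  also says that \<open>p\<close> lies on the orthogonal circle through \<open>z\<close>, whose centre has the inverse
  \<open>2 * p / (1 + p\<^sup>2)\<close>.
\<close>

lemma geodesic_proj_1_eq:
  assumes z: "z \<in> unit_disc" and p: "-1 < p" "p < 1" "p * (1 + (cmod z)\<^sup>2) = Re z * (1 + p\<^sup>2)"
  shows "geodesic_proj 1 z = of_real p"
proof -
  define m where "m = (cmod z)\<^sup>2"
  define D where "D = (\<lambda>x. 1 - 2 * Re z * x + m * x\<^sup>2)"
  have m: "m \<ge> 0" by (simp add: m_def)
  have D_eq: "(cmod (1 - cnj z * of_real x))\<^sup>2 = D x" for x
    unfolding D_def m_def cmod_power2 by (simp add: power2_eq_square algebra_simps)
  have D_pos: "D x > 0" if "-1 < x" "x < 1" for x
    using one_minus_cnj_mult_nonzero[OF z, of "of_real x"] that unfolding D_eq[symmetric] by auto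
  \<comment> \<open>After clearing denominators, the difference of the two sides is a positive multiple of
    \<open>(x - p)\<^sup>2\<close>. The factor \<open>1 + p\<^sup>2\<close> allows \<open>Re z\<close> to be eliminated by the equation for \<open>p\<close>.\<close>
  have max: "(1 - x\<^sup>2) / D x < (1 - p\<^sup>2) / D p" if x: "-1 < x" "x < 1" "x \<noteq> p" for x
  proof -
    have pp: "p\<^sup>2 < 1"
      using p(1,2) by (simp add: abs_square_less_1 abs_less_iff)
    have "(1 + p\<^sup>2) * ((1 - p\<^sup>2) * D x - (1 - x\<^sup>2) * D p) = 
      ((1+p\<^sup>2) - 2 * (Re z * (1+p\<^sup>2)) * x + m * x\<^sup>2*(1+p\<^sup>2)) * (1 - p\<^sup>2)
      - (1 - x\<^sup>2) * ((1+p\<^sup>2) - 2 * (Re z * (1+p\<^sup>2)) * p + m * p\<^sup>2*(1+p\<^sup>2))"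
      by (simp add: D_def algebra_simps)
    also have "\<dots> = (1 - p\<^sup>2) * (1 + m) * (x - p)\<^sup>2"
      unfolding p(3)[symmetric] m_def[symmetric] by (simp add: power2_eq_square algebra_simps)
    also have "\<dots> > 0"
      using x(3) m pp by simp
    finally have "(1 - x\<^sup>2) * D p < (1 - p\<^sup>2) * D x"
      by (smt (verit) zero_less_mult_pos zero_le_power2)
    then show ?thesis
      using D_pos[OF x(1,2)] D_pos[OF p(1,2)] by (simp add: field_simps)
  qed
  have less: "hyp_dist z (of_real p) < hyp_dist z (of_real x)" if "-1 < x" "x < 1" "x \<noteq> p" for x
    using max[OF that] that p z by (subst hyp_dist_less_iff) (auto simp: D_eq)
  show ?thesis
    unfolding geodesic_proj_def
  proof (rule the_equality)
    show "complex_of_real p \<in> diameter_geodesic 1 \<and>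
        (\<forall>q\<in>diameter_geodesic 1. hyp_dist z (of_real p) \<le> hyp_dist z q)"
      using p less by (force simp: diameter_geodesic_def)
  next
    fix q
    assume "q \<in> diameter_geodesic 1 \<and> (\<forall>q'\<in>diameter_geodesic 1. hyp_dist z q \<le> hyp_dist z q')"
    then obtain x where x: "q = of_real x" "-1 < x" "x < 1"
      and "hyp_dist z q \<le> hyp_dist z (of_real p)"
      using p by (auto simp: diameter_geodesic_def image_iff)
    then show "q = of_real p"
      using less[of x] by force
  qed
qed

section \<open>Harmonic measure of an arc seen from the centre\<close>

lemma subharmonic_on_Im:
  assumes F: "F holomorphic_on \<Omega>"
  shows "subharmonic_on (\<lambda>z. Im (F z)) \<Omega>"
  unfolding subharmonic_on_def
proof (intro conjI allI impI)
  show "continuous_on \<Omega> (\<lambda>z. Im (F z))"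
    by (intro continuous_intros holomorphic_on_imp_continuous_on F)
next
  fix z :: complex and r :: real
  assume r: "0 < r \<and> cball z r \<subseteq> \<Omega>"
  have "((\<lambda>u. F u / (u - z)) has_contour_integral 2 * of_real pi * \<i> * F z) (circlepath z r)"
    using r by (intro Cauchy_integral_circlepath_simple holomorphic_on_subset[OF F]) auto
  then have "((\<lambda>t. F (z + r * cis t) / (r * cis t) * r * \<i> * cis t)
      has_integral 2 * of_real pi * \<i> * F z) {0..2 * pi}"
    by (simp add: circlepath_def has_contour_integral_part_circlepath_iff)
  moreover have "F (z + r * cis t) / (r * cis t) * r * \<i> * cis t = \<i> * F (z + r * cis t)" for t
    using r by simp
  ultimately have "((\<lambda>t. \<i> * F (z + r * cis t)) has_integral 2 * of_real pi * \<i> * F z) {0..2 * pi}"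
    by (simp only:)
  then have "((\<lambda>t. - Re (\<i> * F (z + r * cis t))) has_integral - Re (2 * of_real pi * \<i> * F z)) {0..2 * pi}"
    by (intro has_integral_neg has_integral_Re)
  then have "((\<lambda>t. Im (F (z + r * cis t))) has_integral 2 * pi * Im (F z)) {0..2 * pi}"
    by simp
  then show "Im (F z) \<le> 1 / (2 * pi) * integral {0..2 * pi} (\<lambda>\<theta>. Im (F (z + of_real r * cis \<theta>)))"
    by (simp add: integral_unique)
qed

text \<open>
  By the mean value inequality \<open>u 0\<close> is at most the mean of \<open>u\<close> over the circle of radius \<open>r n\<close>, and
  \<open>r n\<close> tends to \<open>1\<close>. Only upper limits of \<open>u\<close> at the boundary are controlled; replacing \<open>u\<close> by its
  maximum with the indicator function turns them into limits and supplies the lower bound needed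
  for dominated convergence.
\<close>

lemma subharmonic_at_0_le_angle_measure:
  assumes sub: "subharmonic_on u unit_disc" and bdd: "bdd_above (u ` unit_disc)"
    and lim: "\<And>\<zeta>. \<zeta> \<in> sphere 0 1 \<Longrightarrow>
      Limsup (at \<zeta> within unit_disc) (\<lambda>z. ereal (u z)) \<le> indicator E \<zeta>"
    and E: "E \<in> sets borel"
  shows "u 0 \<le> measure lborel {t\<in>{0..2 * pi}. cis t \<in> E} / (2 * pi)"
proof -
  define r where "r = (\<lambda>n. 1 - 1 / (real n + 2))"
  have r: "0 < r n" "r n < 1" for n
    by (auto simp: r_def field_simps)
  have r_lim: "r \<longlonglongrightarrow> 1"
    unfolding r_def
    using tendsto_diff[OF tendsto_const[of 1] LIMSEQ_ignore_initial_segment[OF lim_1_over_n, of 2]]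
    by (simp add: add.commute)
  obtain M where M: "\<And>z. z \<in> unit_disc \<Longrightarrow> u z \<le> M"
    using bdd unfolding bdd_above_def by blast
  define M' where "M' = max M 1"
  define h where "h = (\<lambda>n t. max (u (r n * cis t)) (indicator E (cis t)))"
  have disc: "r n * cis t \<in> unit_disc" for n t
    using r[of n] by (simp add: norm_mult)
  have cont: "continuous_on unit_disc u"
    using sub by (simp add: subharmonic_on_def)
  have cont_u: "continuous_on UNIV (\<lambda>t. u (r n * cis t))" for n
    using disc by (intro continuous_on_compose2[OF cont] continuous_intros) auto
  have cis_meas [measurable]: "cis \<in> borel_measurable borel"
    by (intro borel_measurable_continuous_onI continuous_intros)
  have [measurable]: "(\<lambda>t. u (r n * cis t)) \<in> borel_measurable borel" for n
    by (intro borel_measurable_continuous_onI cont_u)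
  have [measurable]: "(\<lambda>t. indicator E (cis t) :: real) \<in> borel_measurable borel"
    using E by measurable
  have h_lim: "(\<lambda>n. h n t) \<longlonglongrightarrow> indicator E (cis t)" for t
  proof (rule order_tendstoI)
    fix a assume "a < (indicator E (cis t) :: real)"
    then show "\<forall>\<^sub>F n in sequentially. a < h n t"
      by (intro always_eventually) (auto simp: h_def)
  next
    fix a assume a: "(indicator E (cis t) :: real) < a"
    have "indicator E (cis t) = ereal (indicator E (cis t))"
      by (simp add: indicator_def)
    then have "Limsup (at (cis t) within unit_disc) (\<lambda>z. ereal (u z)) < ereal a"
      using lim[of "cis t"] a by (simp add: order.strict_trans1)
    then have "\<forall>\<^sub>F z in at (cis t) within unit_disc. u z < a"
      using Limsup_lessD by fastforce
    moreover have "filterlim (\<lambda>n. r n * cis t) (at (cis t) within unit_disc) sequentially"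
      unfolding filterlim_at
    proof (intro conjI always_eventually allI)
      have "(\<lambda>n. r n * cis t) \<longlonglongrightarrow> of_real 1 * cis t"
        by (intro tendsto_intros r_lim)
      then show "(\<lambda>n. r n * cis t) \<longlonglongrightarrow> cis t" by simp
      show "r n * cis t \<noteq> cis t" for n
        using r[of n] by simp
    qed (use disc in auto)
    ultimately have "\<forall>\<^sub>F n in sequentially. u (r n * cis t) < a"
      by (rule eventually_compose_filterlim)
    then show "\<forall>\<^sub>F n in sequentially. h n t < a"
      using a by (auto simp: h_def elim!: eventually_mono)
  qed
  let ?I = "indicator {0..2 * pi} :: real \<Rightarrow> real"
  have h_bound: "norm (?I t *\<^sub>R h n t) \<le> ?I t *\<^sub>R M'" for n t
    using M[OF disc[of n t]] by (auto simp: h_def M'_def indicator_def)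
  have int_M: "integrable lborel (\<lambda>t. ?I t *\<^sub>R M')"
    by (intro integrable_scaleR_left integrable_real_indicator) auto
  have meas_h: "(\<lambda>t. ?I t *\<^sub>R h n t) \<in> borel_measurable lborel" for n
    unfolding h_def by measurable
  have int_h: "integrable lborel (\<lambda>t. ?I t *\<^sub>R h n t)" for n
  proof (rule Bochner_Integration.integrable_bound[OF int_M meas_h], rule AE_I2)
    show "norm (?I t *\<^sub>R h n t) \<le> norm (?I t *\<^sub>R M')" for t
      using h_bound[of t n] by (rule order_trans) simp
  qed
  have "(\<lambda>n. \<integral>t. ?I t *\<^sub>R h n t \<partial>lborel) \<longlonglongrightarrow> (\<integral>t. ?I t *\<^sub>R indicator E (cis t) \<partial>lborel)"
  proof (rule integral_dominated_convergence[OF _ meas_h int_M])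
    show "(\<lambda>t. ?I t *\<^sub>R indicat_real E (cis t)) \<in> borel_measurable lborel"
      by measurable
    show "AE t in lborel. (\<lambda>n. ?I t *\<^sub>R h n t) \<longlonglongrightarrow> ?I t *\<^sub>R indicat_real E (cis t)"
      by (intro AE_I2 tendsto_intros h_lim)
    show "AE t in lborel. norm (?I t *\<^sub>R h n t) \<le> ?I t *\<^sub>R M'" for n
      by (intro AE_I2 h_bound)
  qed
  also have "(\<lambda>t. ?I t *\<^sub>R indicat_real E (cis t)) = indicat_real {t\<in>{0..2 * pi}. cis t \<in> E}"
    by (auto simp: indicator_def)
  finally have lim_int: "(\<lambda>n. \<integral>t. ?I t *\<^sub>R h n t \<partial>lborel)
      \<longlonglongrightarrow> measure lborel {t\<in>{0..2 * pi}. cis t \<in> E}"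
    by simp
  have "2 * pi * u 0 \<le> (\<integral>t. ?I t *\<^sub>R h n t \<partial>lborel)" for n
  proof -
    have sl: "set_integrable lborel {0..2 * pi} (h n)"
      using int_h by (simp add: set_integrable_def)
    have "u 0 \<le> 1 / (2 * pi) * integral {0..2 * pi} (\<lambda>t. u (0 + of_real (r n) * cis t))"
      using sub[unfolded subharmonic_on_def, THEN conjunct2, rule_format, of "r n" 0] r[of n]
      by (simp add: cball_subset_ball_iff)
    then have "2 * pi * u 0 \<le> integral {0..2 * pi} (\<lambda>t. u (r n * cis t))"
      by (simp add: field_simps)
    also have "\<dots> \<le> integral {0..2 * pi} (h n)"
    proof (rule integral_le)
      show "(\<lambda>t. u (r n * cis t)) integrable_on {0..2 * pi}"
        using cont_u by (intro integrable_continuous_real) (rule continuous_on_subset, auto)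
      show "h n integrable_on {0..2 * pi}"
        by (rule set_borel_integral_eq_integral(1)[OF sl])
    qed (simp add: h_def)
    also have "\<dots> = (\<integral>t. ?I t *\<^sub>R h n t \<partial>lborel)"
      using set_borel_integral_eq_integral(2)[OF sl] by (simp add: set_lebesgue_integral_def)
    finally show ?thesis .
  qed
  then have "2 * pi * u 0 \<le> measure lborel {t\<in>{0..2 * pi}. cis t \<in> E}"
    by (intro LIMSEQ_le_const[OF lim_int]) auto
  then show ?thesis
    by (simp add: field_simps)
qed

text \<open>
  The chord from \<open>cis x\<close> to \<open>1\<close> has length \<open>2 * sin (x / 2)\<close>, and its direction turns at half the
  speed of \<open>cis x\<close>. This inscribed angle theorem is what makes the competitor below constant
  on each of the two boundary arcs.
\<close>

lemma Arg_one_minus_cis: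
  assumes "0 < x" "x < 2 * pi"
  shows "Arg (1 - cis x) = (x - pi) / 2"
proof (rule cis_Arg_unique)
  have s: "sin (x / 2) > 0"
    using assms by (intro sin_gt_zero) auto
  have "1 - cis x = of_real (2 * sin (x / 2)) * cis ((x - pi) / 2)"
  proof -
    have "cis ((x - pi) / 2) = - \<i> * cis (x / 2)"
      by (simp add: diff_divide_distrib flip: cis_divide)
    moreover have "cos x = 1 - 2 * (sin (x / 2))\<^sup>2" "sin x = 2 * sin (x / 2) * cos (x / 2)"
      using cos_double_sin[of "x / 2"] sin_double[of "x / 2"] by simp_all
    ultimately show ?thesis
      by (simp add: complex_eq_iff power2_eq_square)
  qed
  then show "sgn (1 - cis x) = cis ((x - pi) / 2)"
    using s by (simp add: sgn_mult sgn_of_real del: of_real_mult)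
  show "- pi < (x - pi) / 2" "(x - pi) / 2 \<le> pi"
    using assms by auto
qed

lemma measure_arc_angles:
  assumes "0 < \<theta>" "\<theta> < pi"
  shows "measure lborel {t\<in>{0..2 * pi}. cis t \<in> cis ` {-\<theta>..\<theta>}} = 2 * \<theta>"
proof -
  have "{t\<in>{0..2 * pi}. cis t \<in> cis ` {-\<theta>..\<theta>}} = {0..\<theta>} \<union> {2 * pi - \<theta>..2 * pi}" (is "?L = ?R")
  proof (intro set_eqI iffI)
    fix t assume t: "t \<in> ?L"
    then obtain s where s: "cis t = cis s" "-\<theta> \<le> s" "s \<le> \<theta>" by auto
    then have "sin t = sin s \<and> cos t = cos s" by (simp add: complex_eq_iff)
    then obtain k :: int where k: "t = s + 2 * pi * k"
      by (auto simp: sin_cos_eq_iff)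
    have "0 \<le> t" "t \<le> 2 * pi"
      using t by auto
    with k s assms have "2 * pi * k < 2 * pi * 2" "2 * pi * (-1) < 2 * pi * k"
      by linarith+
    then have "real_of_int k < 2" "- 1 < real_of_int k"
      by (simp_all only: mult_less_cancel_left_pos pi_gt_zero mult_pos_pos zero_less_numeral)
    then have "k = 0 \<or> k = 1" by auto
    then show "t \<in> ?R"
      using k s t by auto
  next
    fix t assume t: "t \<in> ?R"
    show "t \<in> ?L"
    proof (cases "t \<in> {0..\<theta>}")
      case True
      then show ?thesis using assms by auto
    next
      case False
      have "cis t = cis (t - 2 * pi)" by (simp flip: cis_divide)
      then show ?thesis using t False assms by auto
    qed
  qed
  moreover have "measure lborel ?R = measure lborel {0..\<theta>} + measure lborel {2 * pi - \<theta>..2 * pi}"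
    using assms by (intro measure_Union) auto
  ultimately show ?thesis
    using assms by simp
qed

lemma Re_one_minus_pos:
  assumes "cmod c = 1" "w \<in> unit_disc"
  shows "Re (1 - w * c) > 0"
  using complex_Re_le_cmod[of "w * c"] assms by (simp add: norm_mult)

lemma Im_Ln_one_minus_bounds:
  assumes "cmod c = 1" "w \<in> unit_disc"
  shows "Im (Ln (1 - w * c)) < pi / 2" "- (pi / 2) < Im (Ln (1 - w * c))"
  using Re_Ln_pos_lt_imp[OF Re_one_minus_pos[OF assms]] by auto

lemma tendsto_Im_Ln_one_minus:
  assumes x: "0 < x" "x < 2 * pi" and "\<zeta> * c = cis x"
  shows "((\<lambda>w. Im (Ln (1 - w * c))) \<longlongrightarrow> (x - pi) / 2) (at \<zeta> within S)"
proof -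
  have "sin (x / 2) > 0"
    using x by (intro sin_gt_zero) auto
  then have Re: "Re (1 - cis x) > 0"
    using cos_double_sin[of "x / 2"] by simp
  then have "1 - \<zeta> * c \<notin> \<real>\<^sub>\<le>\<^sub>0"
    using assms(3) by (auto simp: complex_nonpos_Reals_iff)
  then have "((\<lambda>w. Im (Ln (1 - w * c))) \<longlongrightarrow> Im (Ln (1 - \<zeta> * c))) (at \<zeta> within S)"
    by (intro tendsto_intros)
  moreover have "1 - cis x \<noteq> 0"
    using Re by (metis less_irrefl zero_complex.sel(1))
  then have "Im (Ln (1 - \<zeta> * c)) = (x - pi) / 2"
    unfolding assms(3) Arg_one_minus_cis[OF x, symmetric] by (rule Arg_eq_Im_Ln[symmetric])
  ultimately show ?thesis by simp
qed

text \<open>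
  The argument of \<open>1 - w * c\<close> has no limit where \<open>w * c\<close> tends to \<open>1\<close>: it jumps there from \<open>pi / 2\<close>
  to \<open>- pi / 2\<close>. The one-sided bounds needed for an upper limit survive at these points,
  because the argument always lies between the two values. Hence the end points of the arc require
  no separate treatment.
\<close>

lemma eventually_Im_Ln_one_minus_less:
  assumes x: "- 2 * pi < x" "x \<le> 0" and c: "\<zeta> * c = cis x" "cmod c = 1" and y: "(x + pi) / 2 < y"
  shows "\<forall>\<^sub>F w in at \<zeta> within unit_disc. Im (Ln (1 - w * c)) < y"
proof (cases "x = 0")
  case True
  have "\<forall>\<^sub>F w in at \<zeta> within unit_disc. w \<in> unit_disc"
    by (simp add: eventually_at_filter)
  then show ?thesis
    using Im_Ln_one_minus_bounds(1)[OF c(2)] y True by (auto elim!: eventually_mono) (smt (verit))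
next
  case False
  have "\<zeta> * c = cis (x + 2 * pi)"
    by (simp add: c(1) flip: cis_mult)
  then show ?thesis
    using order_tendstoD(2)[OF tendsto_Im_Ln_one_minus[of "x + 2 * pi"]] x y False by simp
qed

lemma eventually_Im_Ln_one_minus_greater:
  assumes x: "0 \<le> x" "x < 2 * pi" and c: "\<zeta> * c = cis x" "cmod c = 1" and y: "y < (x - pi) / 2"
  shows "\<forall>\<^sub>F w in at \<zeta> within unit_disc. y < Im (Ln (1 - w * c))"
proof (cases "x = 0")
  case True
  have "\<forall>\<^sub>F w in at \<zeta> within unit_disc. w \<in> unit_disc"
    by (simp add: eventually_at_filter)
  then show ?thesis
    using Im_Ln_one_minus_bounds(2)[OF c(2)] y True by (auto elim!: eventually_mono) (smt (verit))
next
  case False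
  then show ?thesis
    using order_tendstoD(1)[OF tendsto_Im_Ln_one_minus[OF _ x(2) c(1)] y] x by simp
qed

text \<open>
  The extremal competitor \<open>u\<close> is the Poisson integral of the indicator function of the arc in closed
  form. The angle under which the arc is seen from \<open>z\<close> is the argument of
  \<open>(cis \<theta> - z) / (cis (-\<theta>) - z)\<close>, namely \<open>2 * \<theta> + Arg (1 - z * cis (-\<theta>)) - Arg (1 - z * cis \<theta>)\<close>.
  On the unit circle it is \<open>pi + \<theta>\<close> on the arc and \<open>\<theta>\<close> off it; subtracting \<open>\<theta>\<close> and
  dividing by \<open>pi\<close> gives the boundary values \<open>1\<close> and \<open>0\<close>.
\<close>

lemma harmonic_measure_arc:
  assumes \<theta>: "0 < \<theta>" "\<theta> < pi"
  shows "harmonic_measure 0 (cis ` {-\<theta>..\<theta>}) unit_disc = \<theta> / pi"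
  unfolding harmonic_measure_def
proof (rule cSup_eq_maximum)
  define E where "E = cis ` {-\<theta>..\<theta>}"
  define F where
    "F = (\<lambda>z. (\<i> * of_real \<theta> + Ln (1 - z * cis (-\<theta>)) - Ln (1 - z * cis \<theta>)) / of_real pi)"
  define u where "u = (\<lambda>z. Im (F z))"
  have u_eq: "u z = (\<theta> + Im (Ln (1 - z * cis (-\<theta>))) - Im (Ln (1 - z * cis \<theta>))) / pi" for z
    by (simp add: u_def F_def)
  have "1 - z * cis s \<notin> \<real>\<^sub>\<le>\<^sub>0" if "z \<in> unit_disc" for z s
    using Re_one_minus_pos[OF norm_cis that, of s] by (auto simp: complex_nonpos_Reals_iff)
  then have "F holomorphic_on unit_disc"
    unfolding F_def by (intro holomorphic_intros) auto
  then have sub: "subharmonic_on u unit_disc"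
    unfolding u_def by (rule subharmonic_on_Im)
  have bdd: "bdd_above (u ` unit_disc)"
  proof (rule bdd_aboveI2)
    fix z assume "z \<in> unit_disc"
    then have "\<theta> + Im (Ln (1 - z * cis (-\<theta>))) - Im (Ln (1 - z * cis \<theta>)) \<le> \<theta> + pi"
      using Im_Ln_one_minus_bounds(1)[of "cis (-\<theta>)" z] Im_Ln_one_minus_bounds(2)[of "cis \<theta>" z]
      by simp
    then show "u z \<le> (\<theta> + pi) / pi"
      unfolding u_eq by (intro divide_right_mono) auto
  qed
  \<comment> \<open>Both boundary values come from one estimate: \<open>x\<close> and \<open>y\<close> are the angles of
    \<open>\<zeta> * cis (-\<theta>)\<close> and \<open>\<zeta> * cis \<theta>\<close>, so \<open>2 * \<theta> + x - y\<close> is a multiple of \<open>2 * pi\<close>. The ranges of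
    \<open>x\<close> and \<open>y\<close> allow the value \<open>0\<close> on the arc and \<open>- 2 * pi\<close> off it.\<close>
  have Limsup_le: "Limsup (at \<zeta> within unit_disc) (\<lambda>z. ereal (u z)) \<le> ereal v"
    if x: "- 2 * pi < x" "x \<le> 0" "\<zeta> * cis (-\<theta>) = cis x"
      and y: "0 \<le> y" "y < 2 * pi" "\<zeta> * cis \<theta> = cis y"
      and v: "v = (2 * \<theta> + 2 * pi + x - y) / (2 * pi)" for \<zeta> x y v
    unfolding Limsup_le_iff
  proof (intro allI impI)
    fix b assume "ereal v < b"
    then obtain e where e: "v < e" "ereal e \<le> b"
      by (metis ereal_dense2 less_imp_le less_ereal.simps(1))
    define d where "d = pi * (e - v) / 2"
    have d: "d > 0" using e by (simp add: d_def)
    then have less: "(x + pi) / 2 < (x + pi) / 2 + d" "(y - pi) / 2 - d < (y - pi) / 2"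
      by linarith+
    have "\<forall>\<^sub>F z in at \<zeta> within unit_disc. Im (Ln (1 - z * cis (-\<theta>))) < (x + pi) / 2 + d"
      by (rule eventually_Im_Ln_one_minus_less[OF x norm_cis less(1)])
    moreover have "\<forall>\<^sub>F z in at \<zeta> within unit_disc. (y - pi) / 2 - d < Im (Ln (1 - z * cis \<theta>))"
      by (rule eventually_Im_Ln_one_minus_greater[OF y norm_cis less(2)])
    ultimately show "\<forall>\<^sub>F z in at \<zeta> within unit_disc. ereal (u z) < b"
    proof eventually_elim
      case (elim z)
      then have "\<theta> + Im (Ln (1 - z * cis (-\<theta>))) - Im (Ln (1 - z * cis \<theta>))
          < \<theta> + ((x + pi) / 2 + d) - ((y - pi) / 2 - d)"
        by linarith
      also have "\<dots> = pi * e"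
        unfolding d_def v by (simp add: field_simps)
      finally have "u z < e"
        unfolding u_eq by (simp add: field_simps)
      then have "ereal (u z) < ereal e" by simp
      then show ?case
        using e(2) by (rule order.strict_trans2)
    qed
  qed
  have lim: "Limsup (at \<zeta> within unit_disc) (\<lambda>z. ereal (u z)) \<le> indicator E \<zeta>"
    if "\<zeta> \<in> frontier unit_disc" for \<zeta>
  proof (cases "\<zeta> \<in> E")
    case True
    then obtain t where "\<zeta> = cis t" "-\<theta> \<le> t" "t \<le> \<theta>"
      by (auto simp: E_def)
    then have "Limsup (at \<zeta> within unit_disc) (\<lambda>z. ereal (u z)) \<le> ereal 1"
      using \<theta> by (intro Limsup_le[of "t - \<theta>" _ "t + \<theta>"]) (auto simp: cis_mult)
    then show ?thesis
      using True by (simp add: one_ereal_def)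
  next
    case False
    define t where "t = Arg2pi \<zeta>"
    have t: "0 \<le> t" "t < 2 * pi" and \<zeta>: "\<zeta> = cis t"
      using Arg2pi[of \<zeta>] that complex_norm_eq_1_exp[of \<zeta>] by (auto simp: t_def cis_conv_exp)
    have "\<theta> < t" "t < 2 * pi - \<theta>"
    proof -
      show "\<theta> < t"
        using False t \<theta> unfolding \<zeta> E_def
        by (metis atLeastAtMost_iff image_eqI linorder_not_less neg_le_0_iff_le order.trans order_less_imp_le)
      have "cis t = cis (t - 2 * pi)"
        by (simp flip: cis_divide)
      then show "t < 2 * pi - \<theta>"
        using False t \<theta> unfolding \<zeta> E_def by (force simp: image_iff)
    qed
    moreover have "\<zeta> * cis (-\<theta>) = cis (t - \<theta> - 2 * pi)"
      by (simp add: \<zeta> cis_mult flip: cis_divide[of _ "2 * pi"])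
    ultimately have "Limsup (at \<zeta> within unit_disc) (\<lambda>z. ereal (u z)) \<le> ereal 0"
      using \<theta> by (intro Limsup_le[of "t - \<theta> - 2 * pi" _ "t + \<theta>"]) (auto simp: cis_mult \<zeta>)
    then show ?thesis
      using False by (simp add: zero_ereal_def)
  qed
  have "u 0 = \<theta> / pi"
    by (simp add: u_eq)
  then show "\<theta> / pi \<in> {u 0 |u. subharmonic_on u unit_disc \<and> bdd_above (u ` unit_disc) \<and>
      (\<forall>\<zeta>\<in>frontier unit_disc.
        Limsup (at \<zeta> within unit_disc) (\<lambda>z. ereal (u z)) \<le> indicator (cis ` {-\<theta>..\<theta>}) \<zeta>)}"
    using sub bdd lim unfolding E_def by (intro CollectI exI[of _ u]) auto
next
  fix x
  assume "x \<in> {u 0 |u. subharmonic_on u unit_disc \<and> bdd_above (u ` unit_disc) \<and>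
      (\<forall>\<zeta>\<in>frontier unit_disc.
        Limsup (at \<zeta> within unit_disc) (\<lambda>z. ereal (u z)) \<le> indicator (cis ` {-\<theta>..\<theta>}) \<zeta>)}"
  then obtain u where x: "x = u 0" and u: "subharmonic_on u unit_disc" "bdd_above (u ` unit_disc)"
    "\<And>\<zeta>. \<zeta> \<in> sphere 0 1 \<Longrightarrow>
        Limsup (at \<zeta> within unit_disc) (\<lambda>z. ereal (u z)) \<le> indicator (cis ` {-\<theta>..\<theta>}) \<zeta>"
    by auto
  have "compact (cis ` {-\<theta>..\<theta>})"
    by (intro compact_continuous_image continuous_intros) auto
  then have "cis ` {-\<theta>..\<theta>} \<in> sets borel"
    by (intro borel_closed compact_imp_closed)
  from subharmonic_at_0_le_angle_measure[OF u this] show "x \<le> \<theta> / pi"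
    unfolding measure_arc_angles[OF \<theta>] x by simp
qed

section \<open>Both quantities as functions of the angle\<close>

text \<open>
  The half-angle substitution: for \<open>p = (1 - T) / (1 + T)\<close> with \<open>T = tan (\<theta> / 2)\<close> one has
  \<open>2 * p / (1 + p\<^sup>2) = cos \<theta>\<close>, which is the equation of the projection, and \<open>(1 + p) / (1 - p) = 1 / T\<close>,
  which is the argument of the logarithm in the distance from \<open>0\<close>.
\<close>

lemma orbit_point_angle:
  assumes z: "z \<in> unit_disc" and Re: "Re z > 0"
  obtains \<theta> where "0 < \<theta>" "\<theta> < pi / 2" "upper_endpoint z = cis \<theta>"
    "hyp_dist 0 (geodesic_proj 1 z) = - 1/2 * ln (tan (\<theta> / 2))"
proof -
  define C where "C = 2 * Re z / (1 + (cmod z)\<^sup>2)"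
  have pos: "1 + (cmod z)\<^sup>2 > 0"
    by (intro add_pos_nonneg) auto
  have "2 * Re z < 1 + (cmod z)\<^sup>2"
  proof -
    have "0 < (1 - cmod z)\<^sup>2"
      using z by simp
    then have "2 * cmod z < 1 + (cmod z)\<^sup>2"
      by (simp add: power2_eq_square algebra_simps)
    then show ?thesis
      using complex_Re_le_cmod[of z] by linarith
  qed
  then have C: "0 < C" "C < 1" "C * (1 + (cmod z)\<^sup>2) = 2 * Re z"
    using Re pos by (auto simp: C_def)
  define \<theta> where "\<theta> = arccos C"
  have cos: "cos \<theta> = C"
    using C by (simp add: \<theta>_def)
  have \<theta>: "0 < \<theta>" "\<theta> < pi / 2"
    using C arccos_less_arccos[of C 1] arccos_less_arccos[of 0 C] by (simp_all add: \<theta>_def)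
  define T where "T = tan (\<theta> / 2)"
  have T: "0 < T" "T < 1"
    using \<theta> tan_gt_zero[of "\<theta> / 2"] tan_monotone[of "\<theta> / 2" "pi / 4"] by (auto simp: T_def tan_45)
  have "cos (\<theta> / 2) \<noteq> 0"
    using \<theta> cos_gt_zero[of "\<theta> / 2"] by simp
  then have cos_T: "cos \<theta> = (1 - T\<^sup>2) / (1 + T\<^sup>2)"
    using cos_tan_half[of "\<theta> / 2"] by (simp add: T_def)
  define p where "p = (1 - T) / (1 + T)"
  have nz: "1 + T \<noteq> 0"
    using T by simp
  have pp: "1 + p\<^sup>2 = 2 * (1 + T\<^sup>2) / (1 + T)\<^sup>2"
    using nz by (simp add: p_def divide_simps) (simp add: power2_eq_square algebra_simps)
  have "1 + T\<^sup>2 > 0"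
    by (intro add_pos_nonneg) auto
  then have "C * (1 + p\<^sup>2) = 2 * ((1 - T\<^sup>2) / (1 + T)\<^sup>2)"
    using nz unfolding pp cos_T[unfolded cos] by (simp add: divide_simps) (simp add: algebra_simps)
  also have "(1 - T\<^sup>2) / (1 + T)\<^sup>2 = p"
    using nz by (simp add: p_def divide_simps) (simp add: power2_eq_square algebra_simps)
  finally have "C * (1 + p\<^sup>2) = 2 * p" .
  then have "(2 * Re z) * (1 + p\<^sup>2) = 2 * p * (1 + (cmod z)\<^sup>2)"
    unfolding C(3)[symmetric] by (metis mult.assoc mult.commute)
  moreover have p: "0 < p" "p < 1"
    using T by (auto simp: p_def)
  ultimately have "geodesic_proj 1 z = of_real p"
    using z by (intro geodesic_proj_1_eq) auto
  moreover have "(1 + p) / (1 - p) = 1 / T"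
  proof -
    have "1 + p = 2 / (1 + T)" "1 - p = 2 * T / (1 + T)"
      using nz by (simp_all add: p_def divide_simps)
    then show ?thesis
      using nz T by (simp add: frac_eq_eq)
  qed
  moreover have "hyp_dist 0 (of_real p) = 1/2 * ln ((1 + p) / (1 - p))"
    using p by (simp add: hyp_dist_def)
  ultimately have "hyp_dist 0 (geodesic_proj 1 z) = - 1/2 * ln T"
    using T by (simp only: ln_div) simp
  then show ?thesis
    using that[of \<theta>] \<theta> upper_endpoint_eq_cis[of z \<theta>] z C by (simp add: T_def cos)
qed

text \<open>
  Only the order of magnitude matters. The bound \<open>tan (\<theta> / 2) \<le> \<theta>\<close> uses \<open>cos (\<theta> / 2) \<ge> 1 / 2\<close>, so
  it depends on \<open>\<theta>\<close> staying away from \<open>pi\<close>.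
\<close>

lemma tan_half_bounds:
  assumes "0 < \<theta>" "\<theta> < pi / 2"
  shows "\<theta> / pi \<le> tan (\<theta> / 2)" "tan (\<theta> / 2) \<le> \<theta>"
proof -
  have x: "0 < \<theta> / 2" "\<theta> / 2 < pi / 2"
    using assms by auto
  have c: "1 / 2 \<le> cos (\<theta> / 2)"
    using cos_monotone_0_pi_le[of "\<theta> / 2" "pi / 3"] assms by (simp add: cos_60)
  have "sin (\<theta> / 2) \<le> \<theta> / 2"
    using assms by (intro sin_x_le_x) auto
  also have "\<dots> \<le> \<theta> * cos (\<theta> / 2)"
    using mult_left_mono[OF c, of \<theta>] assms by simp
  finally show "tan (\<theta> / 2) \<le> \<theta>"
    using c by (simp add: tan_def divide_le_eq)
  have "\<theta> / pi \<le> \<theta> / 2"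
    using assms pi_gt3 by (intro divide_left_mono) auto
  also have "\<dots> = arctan (tan (\<theta> / 2))"
    using assms by (simp add: arctan_tan)
  also have "\<dots> \<le> tan (\<theta> / 2)"
    using x tan_gt_zero[of "\<theta> / 2"] by (intro arctan_le_self) auto
  finally show "\<theta> / pi \<le> tan (\<theta> / 2)" .
qed

theorem proposition4p2:
  fixes \<phi> :: "real \<Rightarrow> complex \<Rightarrow> complex"
  assumes "hol_semigroup \<phi>"
    and "non_elliptic \<phi>"
    and "is_Denjoy_Wolff_point \<phi> 1"
  shows "\<exists>K>0. \<forall>t\<ge>1.
    \<bar>orthogonal_speed \<phi> t
      + 1/2 * ln (harmonic_measure 0 (arc_through_1 (upper_endpoint (\<phi> t 0))) unit_disc)\<bar> \<le> K"
proof (intro exI[of _ "1/2 * ln pi"] conjI allI impI)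
  show "0 < 1/2 * ln pi"
    using pi_gt3 by simp
next
  fix t :: real
  assume "t \<ge> 1"
  have DW: "Denjoy_Wolff_point \<phi> = 1"
    unfolding Denjoy_Wolff_point_def
  proof (rule the_equality)
    show "is_Denjoy_Wolff_point \<phi> 1" by (fact assms(3))
  next
    fix \<tau> assume "is_Denjoy_Wolff_point \<phi> \<tau>"
    with assms(3) show "\<tau> = 1"
      unfolding is_Denjoy_Wolff_point_def
      by (metis centre_in_ball tendsto_unique trivial_limit_at_top_linorder zero_less_one)
  qed
  have "\<phi> t ` unit_disc \<subseteq> unit_disc"
    using assms(1) \<open>t \<ge> 1\<close> by (simp add: hol_semigroup_def)
  then have "\<phi> t 0 \<in> unit_disc"
    by (auto simp: image_subset_iff)
  moreover have "Re (\<phi> t 0) > 0"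
    using Re_orbit_pos[OF assms(1,3)] \<open>t \<ge> 1\<close> by simp
  ultimately obtain \<theta> where \<theta>: "0 < \<theta>" "\<theta> < pi / 2" and a: "upper_endpoint (\<phi> t 0) = cis \<theta>"
    and v: "hyp_dist 0 (geodesic_proj 1 (\<phi> t 0)) = - 1/2 * ln (tan (\<theta> / 2))"
    using orbit_point_angle by blast
  have "Arg (cis \<theta>) = \<theta>"
    using \<theta> by (intro cis_Arg_unique) auto
  then have \<omega>: "harmonic_measure 0 (arc_through_1 (upper_endpoint (\<phi> t 0))) unit_disc = \<theta> / pi"
    using \<theta> by (simp add: a arc_through_1_def harmonic_measure_arc)
  have T: "tan (\<theta> / 2) > 0"
    using \<theta> by (intro tan_gt_zero) auto
  have "ln (\<theta> / pi) \<le> ln (tan (\<theta> / 2))"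
    using tan_half_bounds(1)[OF \<theta>] \<theta> T by simp
  moreover have "ln (tan (\<theta> / 2)) \<le> ln (\<theta> / pi) + ln pi"
    using tan_half_bounds(2)[OF \<theta>] \<theta> T by (simp add: ln_div)
  ultimately show "\<bar>orthogonal_speed \<phi> t
      + 1/2 * ln (harmonic_measure 0 (arc_through_1 (upper_endpoint (\<phi> t 0))) unit_disc)\<bar> \<le> 1/2 * ln pi"
    unfolding orthogonal_speed_def DW v \<omega> by linarith
qed

end
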